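(* Let $L=2^{N/2}$ and let $H_{\mathrm{SYK}}(\mathbf{J})$ be the SYK$_q$ Hamiltonian with $N$ Majorana fermions and random couplings $\mathbf{J}$. Let $\mathbf{J}_1,\mathbf{J}_2$ be independent coupling vectors, $H_{\mathrm{SYK}}(\mathbf{J}_i)=V_iD_iV_i^\dagger$ with $D_i$ diagonal, $U_i=e^{-iH_{\mathrm{SYK}}(\mathbf{J}_i)T}$, and suppose the average over the relative eigenbasis rotation $V=V_1^\dagger V_2$ is taken with respect to the Haar measure on $U(L)$, independently of the eigenvalues $D_1,D_2$. Then the first frame potential $\mathcal{F}^{(1)}(T)=\mathbb{E}\,|\mathrm{tr}(U_1^\dagger U_2)|^2$ of the disorder ensemble satisfies $$\mathcal{F}^{(1)}(T)=\frac{\bigl(\mathrm{SFF}(T)-1\bigr)^2}{L^2-1}+1,$$ where $\mathrm{SFF}(T)=\bigl\langle|\mathrm{tr}(e^{-iH_{\mathrm{SYK}}T})|^2\bigr\rangle_{\mathbf{J}}$.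
   Context: SYK model: $N$ (even) Majorana fermions $\psi_1,\dots,\psi_N$ with $\{\psi_i,\psi_j\}=\delta_{ij}$ act on $\mathbb{C}^{L}$, $L=2^{N/2}$. For even $q\ge4$, $H_{\mathrm{SYK}}(\mathbf{J})=i^{q/2}\sum_{i_1<\dots<i_q}J_{i_1\cdots i_q}\psi_{i_1}\cdots\psi_{i_q}$ with independent centered Gaussian couplings of variance $J^2(q-1)!/N^{q-1}$, $J=1$. $\langle\cdot\rangle_{\mathbf{J}}$ is the average over couplings; $\mathrm{tr}$ is the unnormalized trace on $\mathbb{C}^L$. In terms of the eigenvalues $E_a^{(i)}$ of $H_{\mathrm{SYK}}(\mathbf{J}_i)$, $\mathrm{tr}(U_1^\dagger U_2)=\sum_{a,b=1}^L e^{iE_a^{(1)}T}e^{-iE_b^{(2)}T}|V_{ab}|^2$. *)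

theory Defs
  imports "HOL-Probability.Probability"
begin

section \<open>Complex matrices\<close>

definition dagger :: "complex^'n^'m \<Rightarrow> complex^'m^'n" where
  "dagger A = (\<chi> i j. cnj (A $ j $ i))"

definition unitary_mat :: "complex^'n^'n \<Rightarrow> bool" where
  "unitary_mat U \<longleftrightarrow> U ** dagger U = mat 1 \<and> dagger U ** U = mat 1"

definition cscale :: "complex \<Rightarrow> complex^'n^'m \<Rightarrow> complex^'n^'m" where
  "cscale c A = (\<chi> i j. c * A $ i $ j)"

definition diag_mat :: "real^'n \<Rightarrow> complex^'n^'n" where
  "diag_mat E = (\<chi> i j. if i = j then complex_of_real (E $ i) else 0)"

definition matrix_exp :: "complex^'n^'n \<Rightarrow> complex^'n^'n" where
  "matrix_exp A = (\<Sum>k. (((**) A) ^^ k) (mat 1) /\<^sub>R fact k)"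

definition evolution :: "complex^'n^'n \<Rightarrow> real \<Rightarrow> complex^'n^'n" where
  "evolution H T = matrix_exp (cscale (- \<i> * complex_of_real T) H)"

text \<open>The entries of \<open>E\<close> are the eigenvalues of the Hermitian matrix \<open>H\<close>, listed with
  multiplicity (in any order).\<close>

definition has_spectrum :: "complex^'n^'n \<Rightarrow> real^'n \<Rightarrow> bool" where
  "has_spectrum H E \<longleftrightarrow> (\<exists>W. unitary_mat W \<and> H = W ** diag_mat E ** dagger W)"

text \<open>Haar probability measure on the unitary group, as a Borel measure on the ambient matrix
  space concentrated on the unitary matrices. The group is compact, so left invariance determines
  the measure and implies right invariance.\<close>

definition haar_unitary :: "(complex^'n^'n) measure \<Rightarrow> bool" where
  "haar_unitary \<mu> \<longleftrightarrow>
     sets \<mu> = sets borel \<and> prob_space \<mu> \<and> (AE V in \<mu>. unitary_mat V) \<and>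
     (\<forall>U. unitary_mat U \<longrightarrow> distr \<mu> borel (\<lambda>V. U ** V) = \<mu>)"

text \<open>Independence of two random variables with different value types; the library's
  \<open>indep_var\<close> requires equal types.\<close>

definition independent_rvs ::
    "'w measure \<Rightarrow> 'a measure \<Rightarrow> ('w \<Rightarrow> 'a) \<Rightarrow> 'b measure \<Rightarrow> ('w \<Rightarrow> 'b) \<Rightarrow> bool" where
  "independent_rvs M S X R Y \<longleftrightarrow>
     X \<in> measurable M S \<and> Y \<in> measurable M R \<and>
     prob_space.indep_set M {X -` A \<inter> space M |A. A \<in> sets S} {Y -` B \<inter> space M |B. B \<in> sets R}"


section \<open>The SYK model\<close>

text \<open>Self-adjoint generators with \<open>{\<psi>\<^sub>i, \<psi>\<^sub>j} = \<delta>\<^sub>i\<^sub>j\<close>; thus \<open>\<psi>\<^sub>i\<^sup>2 = 1/2\<close>.\<close>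

definition majorana_fermions :: "nat \<Rightarrow> (nat \<Rightarrow> complex^'n^'n) \<Rightarrow> bool" where
  "majorana_fermions N \<psi> \<longleftrightarrow>
     (\<forall>i\<in>{1..N}. dagger (\<psi> i) = \<psi> i) \<and>
     (\<forall>i\<in>{1..N}. \<forall>j\<in>{1..N}. \<psi> i ** \<psi> j + \<psi> j ** \<psi> i = (if i = j then mat 1 else 0))"

text \<open>An increasing tuple \<open>i\<^sub>1 < \<dots> < i\<^sub>q\<close> is encoded by the set of its entries.\<close>

definition coupling_indices :: "nat \<Rightarrow> nat \<Rightarrow> nat set set" where
  "coupling_indices N q = {A. A \<subseteq> {1..N} \<and> card A = q}"

definition majorana_product :: "(nat \<Rightarrow> complex^'n^'n) \<Rightarrow> nat set \<Rightarrow> complex^'n^'n" where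
  "majorana_product \<psi> A = foldr (\<lambda>i B. \<psi> i ** B) (sorted_list_of_set A) (mat 1)"

definition syk_hamiltonian ::
    "nat \<Rightarrow> nat \<Rightarrow> (nat \<Rightarrow> complex^'n^'n) \<Rightarrow> (nat set \<Rightarrow> real) \<Rightarrow> complex^'n^'n" where
  "syk_hamiltonian N q \<psi> J =
     cscale (\<i> ^ (q div 2))
       (\<Sum>A\<in>coupling_indices N q. cscale (complex_of_real (J A)) (majorana_product \<psi> A))"

text \<open>Law of the coupling vector: independent centred Gaussians of variance
  \<open>(q - 1)! / N\<^sup>q\<^sup>-\<^sup>1\<close>. The second argument of \<^const>\<open>normal_density\<close> is the standard deviation.\<close>

definition syk_couplings :: "nat \<Rightarrow> nat \<Rightarrow> (nat set \<Rightarrow> real) measure" where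
  "syk_couplings N q =
     PiM (coupling_indices N q)
       (\<lambda>_. density lborel (normal_density 0 (sqrt (fact (q - 1) / real N ^ (q - 1)))))"

definition spectral_form_factor ::
    "nat \<Rightarrow> nat \<Rightarrow> (nat \<Rightarrow> complex^'n^'n) \<Rightarrow> real \<Rightarrow> real" where
  "spectral_form_factor N q \<psi> T =
     (\<integral>J. (cmod (trace (evolution (syk_hamiltonian N q \<psi> J) T)))\<^sup>2 \<partial>syk_couplings N q)"

definition first_frame_potential ::
    "'w measure \<Rightarrow> ('w \<Rightarrow> complex^'n^'n) \<Rightarrow> ('w \<Rightarrow> complex^'n^'n) \<Rightarrow> real" where
  "first_frame_potential M U1 U2 = (\<integral>\<omega>. (cmod (trace (dagger (U1 \<omega>) ** U2 \<omega>)))\<^sup>2 \<partial>M)"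

text \<open>
  Hamiltonian with eigenbasis \<open>V\<close> and eigenvalues \<open>E\<close>. When the relative rotation
  \<open>V = V\<^sub>1\<^sup>\<dagger> V\<^sub>2\<close> is averaged with the Haar measure, the ensemble consists of
  \<open>H\<^sub>i = V\<^sub>i D\<^sub>i V\<^sub>i\<^sup>\<dagger>\<close> where \<open>D\<^sub>i\<close> has the spectrum of the SYK Hamiltonian with couplings
  \<open>J\<^sub>i\<close>. The case that \<open>H\<^sub>i\<close> equals that SYK Hamiltonian is allowed but must not be demanded,
  because it contradicts the Haar assumption: for \<open>q \<le> N\<close> a Haar distributed \<open>V\<close> independent of
  \<open>D\<^sub>1, D\<^sub>2\<close> gives \<open>E[tr(H\<^sub>1 H\<^sub>2)\<^sup>2] = (E[tr H\<^sup>2])\<^sup>2 / (L\<^sup>2 - 1)\<close>, whereas the Gaussian couplings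
  give \<open>(E[tr H\<^sup>2])\<^sup>2 / (N choose q)\<close>, and \<open>(N choose q) < 2\<^sup>N - 1 = L\<^sup>2 - 1\<close>.
\<close>

definition eigenbasis_hamiltonian :: "complex^'n^'n \<Rightarrow> real^'n \<Rightarrow> complex^'n^'n" where
  "eigenbasis_hamiltonian V E = V ** diag_mat E ** dagger V"

end

theory Submission
  imports Defs
begin

text \<open>
  With \<open>V = V\<^sub>1\<^sup>\<dagger> V\<^sub>2\<close> the trace is \<open>\<Sum>\<^sub>a\<^sub>b x\<^sub>a y\<^sub>b |V\<^sub>a\<^sub>b|\<^sup>2\<close> with phases
  \<open>x\<^sub>a, y\<^sub>b\<close> depending only on the eigenvalues, so its squared modulus involves only the moments
  \<open>E |V\<^sub>a\<^sub>b|\<^sup>2 |V\<^sub>c\<^sub>d|\<^sup>2\<close>. These follow from left invariance alone: for fixed columns \<open>b, d\<close>,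
  rotations in a coordinate plane make \<open>p = E |V\<^sub>a\<^sub>b V\<^sub>a\<^sub>d|\<^sup>2\<close> and
  \<open>r = E |V\<^sub>a\<^sub>b V\<^sub>c\<^sub>d|\<^sup>2\<close> (\<open>a \<noteq> c\<close>) independent of \<open>a, c\<close> and show that the interference term
  \<open>E Re (V\<^sub>a\<^sub>b V\<^sub>c\<^sub>b\<^sup>* V\<^sub>a\<^sub>d\<^sup>* V\<^sub>c\<^sub>d)\<close> equals \<open>p - r\<close>; orthonormality of the columns then
  determines \<open>p\<close> and \<open>r\<close>. Contracting the moments with the phases gives
  \<open>(X - 1) (Y - 1) / (L\<^sup>2 - 1) + 1\<close> with \<open>X = |\<Sum>\<^sub>a x\<^sub>a|\<^sup>2\<close> and \<open>Y = |\<Sum>\<^sub>b y\<^sub>b|\<^sup>2\<close>, which are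
  functions of the independent couplings.
\<close>

section \<open>Unitary and diagonal matrices\<close>

lemma dagger_nth [simp]: "dagger A $ i $ j = cnj (A $ j $ i)"
  by (simp add: dagger_def)

lemma dagger_dagger [simp]: "dagger (dagger A) = A"
  by (simp add: vec_eq_iff)

lemma dagger_matrix_mult: "dagger (A ** B) = dagger B ** dagger A"
  by (simp add: vec_eq_iff matrix_matrix_mult_def mult.commute)

lemma unitary_matD:
  assumes "unitary_mat U"
  shows "U ** dagger U = mat 1" "dagger U ** U = mat 1"
  using assms by (simp_all add: unitary_mat_def)

lemma unitary_mat_dagger_mult:
  assumes "unitary_mat U" "unitary_mat W"
  shows "unitary_mat (dagger U ** W)"
proof -
  have "(dagger U ** W) ** dagger (dagger U ** W) = dagger U ** (W ** dagger W) ** U"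
    by (simp add: dagger_matrix_mult matrix_mul_assoc)
  moreover have "dagger (dagger U ** W) ** (dagger U ** W) = dagger W ** (U ** dagger U) ** W"
    by (simp add: dagger_matrix_mult matrix_mul_assoc)
  ultimately show ?thesis
    using assms by (simp add: unitary_mat_def)
qed

lemma unitary_column_inner:
  assumes "unitary_mat U"
  shows "(\<Sum>a\<in>UNIV. U $ a $ b * cnj (U $ a $ d)) = (if b = d then 1 else 0)"
proof -
  have "(dagger U ** U) $ d $ b = (mat 1 :: complex^'a^'a) $ d $ b"
    using assms by (simp add: unitary_mat_def)
  then show ?thesis
    by (auto simp: matrix_matrix_mult_def mat_def mult.commute)
qed

lemma unitary_column_norm:
  assumes "unitary_mat U"
  shows "(\<Sum>a\<in>UNIV. (cmod (U $ a $ b))\<^sup>2) = 1"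
proof -
  have "complex_of_real (\<Sum>a\<in>UNIV. (cmod (U $ a $ b))\<^sup>2) = 1"
    using unitary_column_inner[OF assms, of b b]
    by (simp add: complex_norm_square del: of_real_power)
  then show ?thesis
    using of_real_eq_1_iff by blast
qed

text \<open>Supplies the constant bounds by which the moment integrands are dominated on a
  probability space.\<close>

lemma unitary_entry_le_1:
  assumes "unitary_mat U"
  shows "cmod (U $ a $ b) \<le> 1"
proof -
  have "(cmod (U $ a $ b))\<^sup>2 \<le> (\<Sum>a\<in>UNIV. (cmod (U $ a $ b))\<^sup>2)"
    by (rule member_le_sum) auto
  then have "(cmod (U $ a $ b))\<^sup>2 \<le> 1\<^sup>2"
    by (simp add: unitary_column_norm[OF assms])
  then show ?thesis
    by (rule power2_le_imp_le) simp
qed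

text \<open>\<open>diag_mat\<close> admits real entries only; after exponentiation the diagonal
  consists of phases.\<close>

definition cdiag :: "('n \<Rightarrow> complex) \<Rightarrow> complex^'n^'n" where
  "cdiag x = (\<chi> i j. if i = j then x i else 0)"

section \<open>Functional calculus for matrices diagonal in a unitary basis\<close>

lemma conj_cdiag_nth:
  "(W ** cdiag x ** dagger W) $ i $ j = (\<Sum>l\<in>UNIV. W $ i $ l * x l * cnj (W $ j $ l))"
  by (simp add: matrix_matrix_mult_def cdiag_def if_distrib cong: if_cong)

lemma conj_cdiag_mult:
  assumes "unitary_mat W"
  shows "(W ** cdiag x ** dagger W) ** (W ** cdiag y ** dagger W) =
    W ** cdiag (\<lambda>l. x l * y l) ** dagger W"
proof -
  have "cdiag x ** cdiag y = cdiag (\<lambda>l. x l * y l)"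
    by (simp add: cdiag_def matrix_matrix_mult_def vec_eq_iff if_distrib[of "\<lambda>z. z * _"] cong: if_cong)
  moreover have "(W ** cdiag x ** dagger W) ** (W ** cdiag y ** dagger W) =
      W ** (cdiag x ** (dagger W ** W) ** cdiag y) ** dagger W"
    by (simp add: matrix_mul_assoc)
  ultimately show ?thesis
    using unitary_matD(2)[OF assms] by simp
qed

lemma conj_cdiag_power:
  assumes "unitary_mat W"
  shows "(((**) (W ** cdiag x ** dagger W)) ^^ k) (mat 1) =
    W ** cdiag (\<lambda>l. x l ^ k) ** dagger W"
proof (induction k)
  case 0
  have "cdiag (\<lambda>l. 1) = (mat 1 :: complex^'a^'a)"
    by (simp add: cdiag_def mat_def vec_eq_iff)
  then show ?case
    using unitary_matD(1)[OF assms] by simp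
next
  case (Suc k)
  then show ?case
    by (simp add: conj_cdiag_mult[OF assms])
qed

text \<open>Each entry of the partial sums is a fixed finite linear combination of partial sums of
  scalar exponential series. This also proves convergence, so the infinite sum in
  \<open>matrix_exp\<close> is a genuine limit.\<close>

lemma matrix_exp_conj_cdiag:
  assumes "unitary_mat W"
  shows "matrix_exp (W ** cdiag x ** dagger W) = W ** cdiag (\<lambda>l. exp (x l)) ** dagger W"
proof -
  have "(\<lambda>k. (W ** cdiag (\<lambda>l. x l ^ k) ** dagger W) /\<^sub>R fact k) sums
      (W ** cdiag (\<lambda>l. exp (x l)) ** dagger W)"
    unfolding sums_def
  proof (intro vec_tendstoI)
    fix i j
    have "(\<lambda>k. \<Sum>l\<in>UNIV. W $ i $ l * (x l ^ k /\<^sub>R fact k) * cnj (W $ j $ l)) sums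
        (\<Sum>l\<in>UNIV. W $ i $ l * exp (x l) * cnj (W $ j $ l))"
      by (intro sums_sum sums_mult sums_mult2 exp_converges)
    then show "(\<lambda>n. (\<Sum>k<n. (W ** cdiag (\<lambda>l. x l ^ k) ** dagger W) /\<^sub>R fact k) $ i $ j)
        \<longlonglongrightarrow> (W ** cdiag (\<lambda>l. exp (x l)) ** dagger W) $ i $ j"
      by (simp add: sums_def conj_cdiag_nth scaleR_sum_right)
  qed
  then show ?thesis
    unfolding matrix_exp_def conj_cdiag_power[OF assms] by (rule sums_unique[symmetric])
qed

lemma evolution_eigenbasis:
  assumes "unitary_mat W"
  shows "evolution (eigenbasis_hamiltonian W E) T =
    W ** cdiag (\<lambda>l. cis (- (E $ l * T))) ** dagger W"
proof -
  have "cscale (- \<i> * complex_of_real T) (W ** diag_mat E ** dagger W) =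
      W ** cdiag (\<lambda>l. - \<i> * complex_of_real T * complex_of_real (E $ l)) ** dagger W"
  proof -
    have diag: "diag_mat E = cdiag (\<lambda>l. complex_of_real (E $ l))"
      by (simp add: diag_mat_def cdiag_def)
    show ?thesis
      unfolding vec_eq_iff diag
      by (simp add: conj_cdiag_nth cscale_def sum_distrib_left mult_ac)
  qed
  then show ?thesis
    by (simp add: evolution_def eigenbasis_hamiltonian_def matrix_exp_conj_cdiag[OF assms]
        cis_conv_exp mult_ac)
qed

section \<open>Traces of evolutions as sums of phases\<close>

lemma trace_conj_cdiag:
  assumes "unitary_mat W"
  shows "trace (W ** cdiag x ** dagger W) = (\<Sum>l\<in>UNIV. x l)"
proof -
  have "trace (W ** cdiag x ** dagger W) = trace (dagger W ** (W ** cdiag x))"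
    by (rule trace_mul_sym)
  also have "\<dots> = trace (cdiag x)"
    by (simp add: matrix_mul_assoc unitary_matD(2)[OF assms])
  finally show ?thesis
    by (simp add: trace_def cdiag_def)
qed

text \<open>Cyclicity of the trace gathers the two bases into the relative rotation
  \<open>dagger V ** W\<close>. The diagonal entries of a conjugated diagonal matrix see only
  squared moduli of that rotation.\<close>

lemma trace_conj_cdiag_mult:
  "trace (dagger (V ** cdiag x ** dagger V) ** (W ** cdiag y ** dagger W)) =
    (\<Sum>a\<in>UNIV. \<Sum>b\<in>UNIV. cnj (x a) * y b * (complex_of_real (cmod ((dagger V ** W) $ a $ b)))\<^sup>2)"
proof -
  have "dagger (cdiag x) = cdiag (\<lambda>a. cnj (x a))"
    by (simp add: cdiag_def vec_eq_iff)
  then have "trace (dagger (V ** cdiag x ** dagger V) ** (W ** cdiag y ** dagger W)) =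
      trace (V ** (cdiag (\<lambda>a. cnj (x a)) ** dagger V ** W ** cdiag y ** dagger W))"
    by (simp add: dagger_matrix_mult matrix_mul_assoc)
  also have "\<dots> = trace (cdiag (\<lambda>a. cnj (x a)) ** dagger V ** W ** cdiag y ** dagger W ** V)"
    by (rule trace_mul_sym)
  also have "\<dots> = trace (cdiag (\<lambda>a. cnj (x a)) ** ((dagger V ** W) ** cdiag y ** dagger (dagger V ** W)))"
    by (simp add: dagger_matrix_mult matrix_mul_assoc)
  also have "\<dots> = (\<Sum>a\<in>UNIV. cnj (x a) *
      ((dagger V ** W) ** cdiag y ** dagger (dagger V ** W)) $ a $ a)"
    unfolding trace_def matrix_matrix_mult_def[of "cdiag (\<lambda>a. cnj (x a))"]
    by (simp add: cdiag_def if_distrib[of "\<lambda>x. x * _"] cong: if_cong)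
  also have "\<dots> = (\<Sum>a\<in>UNIV. \<Sum>b\<in>UNIV. cnj (x a) * y b *
      (complex_of_real (cmod ((dagger V ** W) $ a $ b)))\<^sup>2)"
    unfolding conj_cdiag_nth of_real_power[symmetric] complex_norm_square
    by (simp add: sum_distrib_left mult_ac)
  finally show ?thesis .
qed

section \<open>Second moments of the Haar measure\<close>

lemma haar_integral_left_mult:
  fixes f :: "complex^'n^'n \<Rightarrow> real"
  assumes haar: "haar_unitary \<mu>" and U: "unitary_mat U" and f: "f \<in> borel_measurable borel"
  shows "(\<integral>V. f (U ** V) \<partial>\<mu>) = (\<integral>V. f V \<partial>\<mu>)"
proof -
  have "(\<lambda>V. U ** V) \<in> borel_measurable borel"
    by (rule borel_measurable_continuous_onI)
       (unfold matrix_matrix_mult_def, intro continuous_intros)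
  then have "(\<lambda>V. U ** V) \<in> measurable \<mu> borel"
    using haar by (simp add: haar_unitary_def cong: measurable_cong_sets)
  then have "(\<integral>V. f (U ** V) \<partial>\<mu>) = (\<integral>V. f V \<partial>distr \<mu> borel (\<lambda>V. U ** V))"
    using f by (rule integral_distr[symmetric])
  then show ?thesis
    using haar U by (simp add: haar_unitary_def)
qed

text \<open>An SU(2) rotation with first row (\<alpha>, \<beta>) in the plane of coordinates
  \<open>a\<close> and \<open>c\<close>, for distinct \<open>a\<close>, \<open>c\<close> and
  normalized parameters. Left multiplication mixes two rows and leaves the column index
  alone.\<close>

definition givens :: "'n \<Rightarrow> 'n \<Rightarrow> complex \<Rightarrow> complex \<Rightarrow> complex^'n^'n" where
  "givens a c \<alpha> \<beta> = (\<chi> i j.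
     if i = a then (if j = a then \<alpha> else if j = c then \<beta> else 0)
     else if i = c then (if j = a then - cnj \<beta> else if j = c then cnj \<alpha> else 0)
     else if i = j then 1 else 0)"

lemma givens_mult_nth:
  assumes "a \<noteq> c"
  shows "(givens a c \<alpha> \<beta> ** V) $ i $ j =
    (if i = a then \<alpha> * V $ a $ j + \<beta> * V $ c $ j
     else if i = c then - cnj \<beta> * V $ a $ j + cnj \<alpha> * V $ c $ j
     else V $ i $ j)"
proof -
  have two: "(\<Sum>k\<in>UNIV. (if k = a then u else if k = c then v else 0) * V $ k $ j) =
      u * V $ a $ j + v * V $ c $ j" for u v
  proof -
    have "(\<Sum>k\<in>UNIV. (if k = a then u else if k = c then v else 0) * V $ k $ j) =
        (\<Sum>k\<in>{a, c}. (if k = a then u else if k = c then v else 0) * V $ k $ j)"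
      by (rule sum.mono_neutral_right) auto
    then show ?thesis
      using assms by simp
  qed
  show ?thesis
  proof (cases "i = a \<or> i = c")
    case True
    then show ?thesis
      using two assms by (auto simp: givens_def matrix_matrix_mult_def)
  next
    case False
    then show ?thesis
      by (simp add: givens_def matrix_matrix_mult_def if_distrib[of "\<lambda>x. x * _"] cong: if_cong)
  qed
qed

lemma unitary_givens:
  assumes "a \<noteq> c" and "(cmod \<alpha>)\<^sup>2 + (cmod \<beta>)\<^sup>2 = 1"
  shows "unitary_mat (givens a c \<alpha> \<beta>)"
proof -
  have *: "\<alpha> * cnj \<alpha> + \<beta> * cnj \<beta> = 1"
    using assms(2) by (metis complex_norm_square of_real_1 of_real_add)
  have "givens a c \<alpha> \<beta> ** dagger (givens a c \<alpha> \<beta>) = mat 1"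
    unfolding vec_eq_iff givens_mult_nth[OF assms(1)]
    using assms(1) * by (auto simp: givens_def mat_def algebra_simps)
  then show ?thesis
    by (simp add: unitary_mat_def matrix_left_right_inverse)
qed

lemma cmod_sum_power2:
  fixes z :: "'i \<Rightarrow> complex"
  shows "(cmod (\<Sum>a\<in>A. z a))\<^sup>2 = (\<Sum>a\<in>A. \<Sum>c\<in>A. Re (z a * cnj (z c)))"
proof -
  have "(cmod (\<Sum>a\<in>A. z a))\<^sup>2 = Re ((\<Sum>a\<in>A. z a) * cnj (\<Sum>c\<in>A. z c))"
    by (metis Re_complex_of_real complex_norm_square)
  then show ?thesis
    by (simp add: sum_product cnj_sum)
qed

text \<open>Summing over the phases \<open>\<plusminus>1, \<plusminus>\<i>\<close> removes every term that is not invariant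
  under a common change of phase of \<open>v\<close> and \<open>w\<close>.\<close>

lemma sum_phases_cmod:
  "(\<Sum>z\<in>{1, -1, \<i>, -\<i>}. (cmod (z * v + v'))\<^sup>2 / 2 * ((cmod (z * w + w'))\<^sup>2 / 2)) =
    (cmod v)\<^sup>2 * (cmod w)\<^sup>2 + (cmod v')\<^sup>2 * (cmod w')\<^sup>2 + (cmod v)\<^sup>2 * (cmod w')\<^sup>2 +
    (cmod v')\<^sup>2 * (cmod w)\<^sup>2 + 2 * Re (v * cnj v' * cnj (w * cnj w'))"
proof -
  \<comment> \<open>Distinctness of the four phases lets the sum over the set unfold into four
    terms.\<close>
  have "\<i> \<noteq> -1" "\<i> \<noteq> 1" "- \<i> \<noteq> 1" "- \<i> \<noteq> -1" "\<i> \<noteq> - \<i>" "(1::complex) \<noteq> -1" "1 \<noteq> \<i>" "1 \<noteq> - \<i>" "-1 \<noteq> \<i>" "-1 \<noteq> - \<i>"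
    by (auto simp: complex_eq_iff)
  then show ?thesis
    by (simp add: cmod_power2) (simp add: power2_eq_square field_simps)
qed

text \<open>One formula covers all coincidence patterns: 2 / (L (L + 1)) for equal entries, 1 / (L
  (L + 1)) for entries sharing only a row or only a column, and 1 / (L^2 - 1) otherwise. Two rows
  are needed for \<open>r\<close> to exist and for L^2 - 1 to be nonzero.\<close>

lemma haar_second_moment:
  fixes \<mu> :: "(complex^'n^'n) measure"
  assumes haar: "haar_unitary \<mu>" and card: "CARD('n) \<ge> 2"
  defines "L \<equiv> real CARD('n)"
  shows "(\<integral>V. (cmod (V $ a $ b))\<^sup>2 * (cmod (V $ c $ d))\<^sup>2 \<partial>\<mu>) =
    (1 - (of_bool (a = c) + of_bool (b = d)) / L + of_bool (a = c) * of_bool (b = d)) / (L\<^sup>2 - 1)"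
proof -
  interpret prob_space \<mu>
    using haar by (simp add: haar_unitary_def)
  \<comment> \<open>The columns \<open>b\<close> and \<open>d\<close> stay fixed for the whole
    proof; \<open>a\<close> and \<open>c\<close> are bound anew here as variable row
    indices.\<close>
  define f where "f = (\<lambda>a c (V :: complex^'n^'n). (cmod (V $ a $ b))\<^sup>2 * (cmod (V $ c $ d))\<^sup>2)"
  define g where "g = (\<lambda>a c (V :: complex^'n^'n).
    Re (V $ a $ b * cnj (V $ c $ b) * cnj (V $ a $ d * cnj (V $ c $ d))))"
  define m where "m = (\<lambda>a c. \<integral>V. f a c V \<partial>\<mu>)"
  define s where "s = (\<lambda>a c. \<integral>V. g a c V \<partial>\<mu>)"
  have unitary: "AE V in \<mu>. unitary_mat V"
    using haar by (simp add: haar_unitary_def)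
  have sets: "sets \<mu> = sets borel"
    using haar by (simp add: haar_unitary_def)
  have fm: "f a c \<in> borel_measurable borel" and gm: "g a c \<in> borel_measurable borel" for a c
    unfolding f_def g_def by (intro borel_measurable_continuous_onI continuous_intros)+
  have fi: "integrable \<mu> (f a c)" for a c
  proof (rule integrable_const_bound[where B = 1])
    show "AE V in \<mu>. norm (f a c V) \<le> 1"
      using unitary
    proof eventually_elim
      case (elim V)
      then show ?case
        using unitary_entry_le_1[OF elim]
        by (auto simp: f_def intro!: mult_le_one power_le_one)
    qed
    show "f a c \<in> borel_measurable \<mu>"
      using fm[of a c] sets by (simp cong: measurable_cong_sets)
  qed
  have gi: "integrable \<mu> (g a c)" for a c
  proof (rule integrable_const_bound[where B = 1])
    show "AE V in \<mu>. norm (g a c V) \<le> 1"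
      using unitary
    proof eventually_elim
      case (elim V)
      have "cmod (V $ a $ b * cnj (V $ c $ b) * cnj (V $ a $ d * cnj (V $ c $ d))) \<le> 1"
        using unitary_entry_le_1[OF elim]
        by (auto simp: norm_mult intro!: mult_le_one)
      then show ?case
        unfolding g_def real_norm_def by (rule order_trans[OF abs_Re_le_cmod])
    qed
    show "g a c \<in> borel_measurable \<mu>"
      using gm[of a c] sets by (simp cong: measurable_cong_sets)
  qed
  have swap: "m (Transposition.transpose i j k) (Transposition.transpose i j l) = m k l" for i j k l
  proof (cases "i = j")
    case False
    \<comment> \<open>This rotation exchanges rows \<open>i\<close> and \<open>j\<close> up to a
      sign, which the moduli in \<open>f\<close> do not see.\<close>
    have "(\<integral>V. f k l (givens i j 0 1 ** V) \<partial>\<mu>) = m k l"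
      unfolding m_def
      by (intro haar_integral_left_mult[OF haar] unitary_givens fm) (use False in auto)
    moreover have "f k l (givens i j 0 1 ** V) = f (Transposition.transpose i j k) (Transposition.transpose i j l) V" for V
      using False by (auto simp: f_def givens_mult_nth transpose_def)
    ultimately show ?thesis
      by (simp add: m_def)
  qed simp
  \<comment> \<open>Any row other than \<open>a\<close> serves as reference for the off-diagonal
    value; \<open>off\<close> shows that the choice is immaterial.\<close>
  define p r where "p = m a a" and "r = m a (SOME c. c \<noteq> a)"
  have diag: "m i i = p" for i
    using swap[of i a a a] by (simp add: p_def)
  have "\<exists>c. c \<noteq> a"
  proof (rule ccontr)
    assume "\<not> (\<exists>c. c \<noteq> a)"
    then have "(UNIV :: 'n set) = {a}"
      by auto
    then show False
      using card by (metis One_nat_def card.empty card_insert_disjoint empty_iff finite.emptyI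
          not_less_eq_eq numeral_2_eq_2 order_refl)
  qed
  then have a_neq: "(SOME c. c \<noteq> a) \<noteq> a"
    by (rule someI_ex)
  have off: "m i j = r" if "i \<noteq> j" for i j
  proof -
    \<comment> \<open>A first transposition takes \<open>i\<close> to \<open>a\<close> and
      \<open>j\<close> to \<open>k\<close>. A second one moves \<open>k\<close> to the reference row
      and fixes \<open>a\<close>, which differs from both.\<close>
    define k where "k = Transposition.transpose i a j"
    have "k \<noteq> a"
      using that by (metis k_def transpose_apply_second transpose_involutory transpose_apply_first)
    have "m i j = m a k"
      using swap[of i a i j] by (simp add: k_def)
    also have "\<dots> = m a (SOME c. c \<noteq> a)"
      using swap[of k "SOME c. c \<noteq> a" a k] \<open>k \<noteq> a\<close> a_neq
      by (simp add: transpose_apply_other)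
    finally show ?thesis
      by (simp add: r_def)
  qed
  have s_off: "s i j = p - r" if "i \<noteq> j" for i j
  proof -
    \<comment> \<open>The rotation with first row (z, 1) / sqrt 2 turns row \<open>i\<close> into (z
      V_i + V_j) / sqrt 2, so invariance of \<open>m i i\<close> gives the value \<open>p\<close>
      for every phase \<open>z\<close>. Each division by 2 is a squared 1 / sqrt 2.\<close>
    have "(\<integral>V. (cmod (z * V $ i $ b + V $ j $ b))\<^sup>2 / 2 * ((cmod (z * V $ i $ d + V $ j $ d))\<^sup>2 / 2) \<partial>\<mu>) = p"
      (is "?I z = p") and
      "integrable \<mu> (\<lambda>V. (cmod (z * V $ i $ b + V $ j $ b))\<^sup>2 / 2 * ((cmod (z * V $ i $ d + V $ j $ d))\<^sup>2 / 2))"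
      if "cmod z = 1" for z
    proof -
      have G: "unitary_mat (givens i j (z / complex_of_real (sqrt 2)) (1 / complex_of_real (sqrt 2)))"
        by (rule unitary_givens)
           (use \<open>i \<noteq> j\<close> that in \<open>auto simp: norm_divide power_divide\<close>)
      have *: "(cmod (z / complex_of_real (sqrt 2) * x + 1 / complex_of_real (sqrt 2) * y))\<^sup>2 = (cmod (z * x + y))\<^sup>2 / 2" for x y
      proof -
        have "z / complex_of_real (sqrt 2) * x + 1 / complex_of_real (sqrt 2) * y = (z * x + y) / complex_of_real (sqrt 2)"
          by (simp add: add_divide_distrib)
        then show ?thesis
          by (simp add: norm_divide power_divide)
      qed
      have eq: "f i i (givens i j (z / complex_of_real (sqrt 2)) (1 / complex_of_real (sqrt 2)) ** V) =
          (cmod (z * V $ i $ b + V $ j $ b))\<^sup>2 / 2 * ((cmod (z * V $ i $ d + V $ j $ d))\<^sup>2 / 2)" for V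
        unfolding f_def givens_mult_nth[OF \<open>i \<noteq> j\<close>] by (simp only: * if_True refl)
      have "?I z = (\<integral>V. f i i (givens i j (z / complex_of_real (sqrt 2)) (1 / complex_of_real (sqrt 2)) ** V) \<partial>\<mu>)"
        by (simp only: eq)
      also have "\<dots> = p"
        using haar_integral_left_mult[OF haar G fm] diag by (simp add: m_def)
      finally show "?I z = p" .
      show "integrable \<mu> (\<lambda>V. (cmod (z * V $ i $ b + V $ j $ b))\<^sup>2 / 2 * ((cmod (z * V $ i $ d + V $ j $ d))\<^sup>2 / 2))"
      \<comment> \<open>A sum of two entries of modulus at most 1 has squared modulus at most 4, so
        each halved factor is at most 2.\<close>
      proof (rule integrable_const_bound[where B = 4])
        show "AE V in \<mu>. norm ((cmod (z * V $ i $ b + V $ j $ b))\<^sup>2 / 2 * ((cmod (z * V $ i $ d + V $ j $ d))\<^sup>2 / 2)) \<le> 4"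
          using unitary
        proof eventually_elim
          case (elim V)
          have "(cmod (z * V $ i $ e + V $ j $ e))\<^sup>2 / 2 \<le> 2" for e
          proof -
            have "cmod (z * V $ i $ e + V $ j $ e) \<le> 1 + 1"
              using unitary_entry_le_1[OF elim] that
              by (intro norm_triangle_le add_mono) (auto simp: norm_mult)
            then have "(cmod (z * V $ i $ e + V $ j $ e))\<^sup>2 \<le> 2\<^sup>2"
              by (intro power_mono) auto
            then show ?thesis
              by simp
          qed
          from mult_mono[OF this this, of b d] show ?case
            by (simp add: mult.commute)
        qed
        have "(\<lambda>V. (cmod (z * V $ i $ b + V $ j $ b))\<^sup>2 / 2 * ((cmod (z * V $ i $ d + V $ j $ d))\<^sup>2 / 2))
            \<in> borel_measurable borel"
          by (intro borel_measurable_continuous_onI continuous_intros) auto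
        then show "(\<lambda>V. (cmod (z * V $ i $ b + V $ j $ b))\<^sup>2 / 2 * ((cmod (z * V $ i $ d + V $ j $ d))\<^sup>2 / 2))
            \<in> borel_measurable \<mu>"
          using sets by (simp cong: measurable_cong_sets)
      qed
    qed
    note I = this
    have "(\<integral>V. (\<Sum>z\<in>{1, -1, \<i>, -\<i>}. (cmod (z * V $ i $ b + V $ j $ b))\<^sup>2 / 2 *
        ((cmod (z * V $ i $ d + V $ j $ d))\<^sup>2 / 2)) \<partial>\<mu>) = (\<Sum>z\<in>{1, -1, \<i>, -\<i>}.
        \<integral>V. (cmod (z * V $ i $ b + V $ j $ b))\<^sup>2 / 2 * ((cmod (z * V $ i $ d + V $ j $ d))\<^sup>2 / 2) \<partial>\<mu>)"
      by (rule Bochner_Integration.integral_sum, rule I(2)) auto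
    also have "\<dots> = (\<Sum>z\<in>{1, -1, \<i>, -\<i>}. p)"
      by (rule sum.cong[OF refl], rule I(1)) auto
    also have "\<dots> = 4 * p"
      by (simp add: complex_eq_iff)
    \<comment> \<open>On the right two terms integrate to \<open>p\<close>, two to \<open>r\<close>
      and the last to \<open>2 * s i j\<close>, hence \<open>s i j = p - r\<close>.\<close>
    finally have "4 * p = (\<integral>V. f i i V + f j j V + f i j V + f j i V + 2 * g i j V \<partial>\<mu>)"
      unfolding sum_phases_cmod by (simp add: f_def g_def)
    also have "\<dots> = m i i + m j j + m i j + m j i + 2 * s i j"
      using fi gi by (simp add: m_def s_def)
    finally show ?thesis
      using diag[of i] diag[of j] off[OF that] off[of j i] that by simp
  qed
  have s_diag: "s i i = p" for i
  proof -
    have "v * cnj v * cnj (w * cnj w) = complex_of_real ((cmod v)\<^sup>2 * (cmod w)\<^sup>2)" for v w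
      by (simp add: complex_norm_square del: of_real_power)
    then have "g i i = f i i"
      unfolding f_def g_def by (simp only: Re_complex_of_real)
    then show ?thesis
      using diag[of i] by (simp add: m_def s_def)
  qed
  have total: "(\<Sum>i\<in>(UNIV :: 'n set). \<Sum>j\<in>UNIV. (if i = j then u else v)) = L * u + L * (L - 1) * v"
    for u v :: real
  proof -
    have "(\<Sum>j\<in>UNIV. (if i = j then u else v)) = u + (L - 1) * v" for i :: 'n
    proof -
      have "(\<Sum>j\<in>UNIV. (if i = j then u else v)) = (\<Sum>j\<in>UNIV. v + (if i = j then u - v else 0))"
        by (rule sum.cong) auto
      also have "\<dots> = L * v + (u - v)"
        by (simp add: sum.distrib L_def)
      finally show ?thesis
        by (simp add: algebra_simps)
    qed
    then have "(\<Sum>i\<in>(UNIV :: 'n set). \<Sum>j\<in>UNIV. (if i = j then u else v)) = (\<Sum>i\<in>(UNIV :: 'n set). u + (L - 1) * v)"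
      by (simp only:)
    then show ?thesis
      by (simp add: L_def algebra_simps)
  qed
  \<comment> \<open>Summed over both rows, \<open>f\<close> becomes the product of the squared norms
    of columns \<open>b\<close> and \<open>d\<close>.\<close>
  have "(\<Sum>i\<in>UNIV. \<Sum>j\<in>UNIV. m i j) = 1"
  proof -
    have "(\<Sum>i\<in>UNIV. \<Sum>j\<in>UNIV. m i j) = (\<integral>V. (\<Sum>i\<in>UNIV. \<Sum>j\<in>UNIV. f i j V) \<partial>\<mu>)"
      using fi by (simp add: m_def)
    also have "\<dots> = (\<integral>V. 1 \<partial>\<mu>)"
    proof (rule integral_cong_AE)
      show "AE V in \<mu>. (\<Sum>i\<in>UNIV. \<Sum>j\<in>UNIV. f i j V) = 1"
        using unitary
      proof eventually_elim
        case (elim V)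
        then show ?case
          by (simp add: f_def sum_product[symmetric] unitary_column_norm)
      qed
    qed (use fi borel_measurable_integrable in \<open>auto intro!: borel_measurable_sum\<close>)
    finally show ?thesis
      by (simp add: prob_space)
  qed
  moreover have "m i j = (if i = j then p else r)" for i j
    using diag off by auto
  ultimately have m_sum: "L * p + L * (L - 1) * r = 1"
    using total[of p r] by simp
  \<comment> \<open>Summed over both rows, \<open>g\<close> becomes the squared modulus of the inner
    product of columns \<open>b\<close> and \<open>d\<close>.\<close>
  have "(\<Sum>i\<in>UNIV. \<Sum>j\<in>UNIV. s i j) = of_bool (b = d)"
  proof -
    have "(\<Sum>i\<in>UNIV. \<Sum>j\<in>UNIV. s i j) = (\<integral>V. (\<Sum>i\<in>UNIV. \<Sum>j\<in>UNIV. g i j V) \<partial>\<mu>)"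
      using gi by (simp add: s_def)
    also have "\<dots> = (\<integral>V. of_bool (b = d) \<partial>\<mu>)"
    proof (rule integral_cong_AE)
      show "AE V in \<mu>. (\<Sum>i\<in>UNIV. \<Sum>j\<in>UNIV. g i j V) = of_bool (b = d)"
        using unitary
      proof eventually_elim
        case (elim V)
        have "(\<Sum>i\<in>UNIV. \<Sum>j\<in>UNIV. g i j V) = (cmod (\<Sum>i\<in>UNIV. V $ i $ b * cnj (V $ i $ d)))\<^sup>2"
          unfolding cmod_sum_power2 g_def by (intro sum.cong refl arg_cong[of _ _ Re]) (simp add: mult_ac)
        then show ?case
          by (simp add: unitary_column_inner[OF elim])
      qed
    qed (use gi borel_measurable_integrable in \<open>auto intro!: borel_measurable_sum\<close>)
    finally show ?thesis
      by (simp add: prob_space)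
  qed
  moreover have "s i j = (if i = j then p else p - r)" for i j
    using s_diag s_off by auto
  ultimately have s_sum: "L * p + L * (L - 1) * (p - r) = of_bool (b = d)"
    using total[of p "p - r"] by simp
  have L: "L \<ge> 2"
    using card by (simp add: L_def)
  have factored: "L\<^sup>2 - 1 = (L - 1) * (L + 1)"
    by algebra
  \<comment> \<open>Adding \<open>m_sum\<close> and \<open>s_sum\<close> cancels \<open>r\<close>
    and leaves L (L + 1) p.\<close>
  have p: "p = (1 + of_bool (b = d)) / (L * (L + 1))"
  proof -
    have "p * (L * (L + 1)) = 1 + of_bool (b = d)"
      using m_sum s_sum by (simp add: algebra_simps)
    moreover have "L * (L + 1) \<noteq> 0"
      using L by simp
    ultimately show ?thesis
      by (metis nonzero_mult_div_cancel_right)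
  qed
  have r: "r = (1 - of_bool (b = d) / L) / (L\<^sup>2 - 1)"
  proof -
    have "L\<^sup>2 - 1 \<noteq> 0"
      using L by (smt (verit) one_power2 power2_eq_imp_eq)
    moreover have "r * (L\<^sup>2 - 1) * L = L - of_bool (b = d)"
    proof -
      have "L * p * (L + 1) = 1 + of_bool (b = d)"
        using m_sum s_sum by (simp add: algebra_simps)
      moreover have "L * p * (L + 1) + L * (L - 1) * r * (L + 1) = L + 1"
        using arg_cong[OF m_sum, of "\<lambda>x. x * (L + 1)"] by (simp add: algebra_simps)
      moreover have "r * (L\<^sup>2 - 1) * L = L * (L - 1) * r * (L + 1)"
        unfolding factored by (simp only: mult_ac)
      ultimately show ?thesis
        by linarith
    qed
    ultimately show ?thesis
      using L by (simp add: field_simps)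
  qed
  have "m a c = (1 - (of_bool (a = c) + of_bool (b = d)) / L + of_bool (a = c) * of_bool (b = d)) / (L\<^sup>2 - 1)"
  proof (cases "a = c")
    case True
    have "L - 1 \<noteq> 0" "L + 1 \<noteq> 0" "L \<noteq> 0"
      using L by auto
    \<comment> \<open>Here \<open>t\<close> stands for \<open>of_bool (b = d)\<close>; the identity
      brings \<open>p\<close> into the uniform form.\<close>
    then have "(1 + t) / (L * (L + 1)) = (1 - (1 + t) / L + t) / (L\<^sup>2 - 1)" for t
      unfolding factored by (simp add: divide_simps) (simp add: algebra_simps)
    then show ?thesis
      using True diag[of c] p by simp
  next
    case False
    then show ?thesis
      using off r by simp
  qed
  then show ?thesis
    by (simp add: m_def f_def)
qed

section \<open>Independence\<close>

text \<open>Composition with real functions brings both variables to one type, where the product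
  rule for \<open>indep_var\<close> applies. Independence survives because preimages under a
  composition are among the preimages under the original variable.\<close>

lemma (in prob_space) independent_rvs_integral_mult:
  fixes f :: "'b \<Rightarrow> real" and g :: "'c \<Rightarrow> real"
  assumes indep: "independent_rvs M S X R Y"
    and f: "f \<in> borel_measurable S" and g: "g \<in> borel_measurable R"
    and fi: "integrable M (\<lambda>\<omega>. f (X \<omega>))" and gi: "integrable M (\<lambda>\<omega>. g (Y \<omega>))"
  shows "(\<integral>\<omega>. f (X \<omega>) * g (Y \<omega>) \<partial>M) = (\<integral>\<omega>. f (X \<omega>) \<partial>M) * (\<integral>\<omega>. g (Y \<omega>) \<partial>M)" (is ?eq)
    and "integrable M (\<lambda>\<omega>. f (X \<omega>) * g (Y \<omega>))" (is ?int)
proof -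
  have XY: "X \<in> measurable M S" "Y \<in> measurable M R"
    using indep by (auto simp: independent_rvs_def)
  \<comment> \<open>\<open>indep_var\<close> speaks of generated sigma-algebras; passing to them
    from the preimage families requires stability under intersection.\<close>
  have stable: "Int_stable {Z -` A \<inter> space M | A. A \<in> sets Q}" for Z :: "'a \<Rightarrow> 'd" and Q
  proof (rule Int_stableI, clarify)
    fix A B assume "A \<in> sets Q" "B \<in> sets Q"
    then show "\<exists>C. (Z -` A \<inter> space M) \<inter> (Z -` B \<inter> space M) = Z -` C \<inter> space M \<and> C \<in> sets Q"
      by (intro exI[of _ "A \<inter> B"]) auto
  qed
  have preimage: "{(h \<circ> Z) -` A \<inter> space M | A. A \<in> sets borel} \<subseteq> {Z -` A \<inter> space M | A. A \<in> sets Q}"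
    if "h \<in> borel_measurable Q" "Z \<in> measurable M Q" for h :: "'d \<Rightarrow> real" and Z Q
  proof clarify
    fix A :: "real set" assume "A \<in> sets borel"
    then have "h -` A \<inter> space Q \<in> sets Q"
      using that(1) by (rule measurable_sets[rotated])
    moreover have "(h \<circ> Z) -` A \<inter> space M = Z -` (h -` A \<inter> space Q) \<inter> space M"
      using measurable_space[OF that(2)] by auto
    ultimately show "\<exists>B. (h \<circ> Z) -` A \<inter> space M = Z -` B \<inter> space M \<and> B \<in> sets Q"
      by blast
  qed
  have "indep_set {(f \<circ> X) -` A \<inter> space M | A. A \<in> sets borel} {(g \<circ> Y) -` A \<inter> space M | A. A \<in> sets borel}"
    unfolding indep_set_def
  proof (rule indep_sets_mono_sets)
    show "indep_sets (case_bool {X -` A \<inter> space M | A. A \<in> sets S} {Y -` B \<inter> space M | B. B \<in> sets R}) UNIV"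
      using indep by (simp add: independent_rvs_def indep_set_def)
    show "case_bool {(f \<circ> X) -` A \<inter> space M | A. A \<in> sets borel}
        {(g \<circ> Y) -` A \<inter> space M | A. A \<in> sets borel} i \<subseteq>
        case_bool {X -` A \<inter> space M | A. A \<in> sets S} {Y -` B \<inter> space M | B. B \<in> sets R} i" for i
      using preimage[OF f XY(1)] preimage[OF g XY(2)] by (cases i) simp_all
  qed
  then have "indep_var borel (f \<circ> X) borel (g \<circ> Y)"
    unfolding indep_var_eq using XY f g
    by (auto intro!: indep_set_sigma_sets stable)
  from indep_var_lebesgue_integral[OF this] indep_var_integrable[OF this] show ?eq ?int
    using fi gi by (simp_all add: comp_def)
qed

section \<open>The frame potential\<close>

lemma borel_measurable_matrix_exp [measurable]:
  "(matrix_exp :: complex^'n^'n \<Rightarrow> complex^'n^'n) \<in> borel_measurable borel"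
proof -
  have "continuous_on UNIV (\<lambda>A :: complex^'n^'n. (((**) A) ^^ k) (mat 1))" for k
  proof (induction k)
    case (Suc k)
    then show ?case
      unfolding funpow.simps comp_def matrix_matrix_mult_def by (intro continuous_intros)
  qed simp
  then have [measurable]: "(\<lambda>A :: complex^'n^'n. (((**) A) ^^ k) (mat 1)) \<in> borel_measurable borel" for k
    by (rule borel_measurable_continuous_onI)
  show ?thesis
    unfolding matrix_exp_def[abs_def] by measurable
qed

text \<open>Lets averages over \<open>M\<close> be rewritten as averages over the law of the
  couplings, and carries independence of the couplings over to the form factors.\<close>

lemma borel_measurable_syk_form_factor:
  "(\<lambda>J. (cmod (trace (evolution (syk_hamiltonian N q \<psi> J) T)))\<^sup>2)
    \<in> borel_measurable (syk_couplings N q)"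
proof -
  have scale: "(cscale c :: complex^'n^'n \<Rightarrow> complex^'n^'n) \<in> borel_measurable borel" for c
    unfolding cscale_def[abs_def]
    by (intro borel_measurable_continuous_onI continuous_intros)
  have coeff: "(\<lambda>J. cscale (complex_of_real (J A)) (majorana_product \<psi> A))
      \<in> borel_measurable (syk_couplings N q)"
    if "A \<in> coupling_indices N q" for A
  proof -
    have "(\<lambda>J. J A) \<in> borel_measurable (syk_couplings N q)"
      unfolding syk_couplings_def
      using measurable_component_singleton[OF that,
          of "\<lambda>_. density lborel (normal_density 0 (sqrt (fact (q - 1) / real N ^ (q - 1))))"]
      by (simp cong: measurable_cong_sets)
    moreover have "(\<lambda>t. cscale (complex_of_real t) (majorana_product \<psi> A)) \<in> borel_measurable borel"
      unfolding cscale_def by (intro borel_measurable_continuous_onI continuous_intros)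
    ultimately show ?thesis
      by (rule measurable_compose)
  qed
  have "(\<lambda>J. evolution (syk_hamiltonian N q \<psi> J) T) \<in> borel_measurable (syk_couplings N q)"
    unfolding evolution_def syk_hamiltonian_def
    by (intro measurable_compose[OF _ borel_measurable_matrix_exp] measurable_compose[OF _ scale]
        borel_measurable_sum coeff)
  moreover have "(\<lambda>A :: complex^'n^'n. (cmod (trace A))\<^sup>2) \<in> borel_measurable borel"
    unfolding trace_def by (intro borel_measurable_continuous_onI continuous_intros)
  ultimately show ?thesis
    by (rule measurable_compose)
qed

section \<open>Contraction of the moments with the phases\<close>

lemma sum4_product:
  fixes F G :: "'i \<Rightarrow> 'i \<Rightarrow> 'a :: comm_semiring_0"
  shows "(\<Sum>a\<in>A. \<Sum>c\<in>A. \<Sum>b\<in>A. \<Sum>d\<in>A. F a c * G b d) = (\<Sum>a\<in>A. \<Sum>c\<in>A. F a c) * (\<Sum>b\<in>A. \<Sum>d\<in>A. G b d)"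
  by (simp only: sum_distrib_left[symmetric] sum_distrib_right[symmetric])

lemma Re_mult_of_real: "Re (z * complex_of_real r) = Re z * r"
  by simp

text \<open>The summation order a, c, b, d separates the row phases from the column phases, as
  \<open>sum4_product\<close> requires.\<close>

lemma cmod_bilinear_sum_power2:
  fixes x y :: "'i \<Rightarrow> complex" and P :: "'i \<Rightarrow> 'i \<Rightarrow> real"
  shows "(cmod (\<Sum>a\<in>A. \<Sum>b\<in>A. x a * y b * P a b))\<^sup>2 =
    (\<Sum>a\<in>A. \<Sum>c\<in>A. \<Sum>b\<in>A. \<Sum>d\<in>A. Re (x a * cnj (x c) * (y b * cnj (y d))) * (P a b * P c d))"
proof -
  have "Re (x a * cnj (x c) * (y b * cnj (y d))) * (P a b * P c d) =
      Re (x a * y b * P a b * cnj (x c * y d * P c d))" for a b c d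
  proof -
    have "x a * y b * P a b * cnj (x c * y d * P c d) =
        x a * cnj (x c) * (y b * cnj (y d)) * complex_of_real (P a b * P c d)"
      by simp
    then show ?thesis
      by (simp only: Re_mult_of_real)
  qed
  then show ?thesis
    unfolding cmod_sum_power2 cnj_sum sum_product Re_sum by (simp only:)
qed

text \<open>With X and Y the squared moduli of the two phase sums, the four parts of the weight
  contribute X Y, - Y, - X and L^2, because a diagonal sum of unit phases times their conjugates is
  L.\<close>

lemma haar_weighted_phase_sum:
  fixes x y :: "'n::finite \<Rightarrow> complex"
  assumes x: "\<And>a. cmod (x a) = 1" and y: "\<And>b. cmod (y b) = 1"
  defines "L \<equiv> real CARD('n)"
  shows "(\<Sum>a\<in>UNIV. \<Sum>c\<in>UNIV. \<Sum>b\<in>UNIV. \<Sum>d\<in>UNIV. Re (x a * cnj (x c) * (y b * cnj (y d))) *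
      (1 - (of_bool (a = c) + of_bool (b = d)) / L + of_bool (a = c) * of_bool (b = d))) =
    ((cmod (\<Sum>a\<in>UNIV. x a))\<^sup>2 - 1) * ((cmod (\<Sum>b\<in>UNIV. y b))\<^sup>2 - 1) + (L\<^sup>2 - 1)"
    (is "?lhs = ?rhs")
proof -
  \<comment> \<open>With the indicator absorbed here, each part of the weighted summand is a
    function of (a, c) times a function of (b, d).\<close>
  define D where "D = (\<lambda>(u :: 'n \<Rightarrow> complex) a c. of_bool (a = c) * (u a * cnj (u c)))"
  have full: "(\<Sum>a\<in>UNIV. \<Sum>c\<in>UNIV. u a * cnj (u c)) = complex_of_real ((cmod (\<Sum>a\<in>UNIV. u a))\<^sup>2)"
    for u :: "'n \<Rightarrow> complex"
    unfolding complex_norm_square cnj_sum sum_product ..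
  have diag: "(\<Sum>a\<in>UNIV. \<Sum>c\<in>UNIV. D u a c) = complex_of_real L" if "\<And>a. cmod (u a) = 1" for u
  proof -
    have "u a * cnj (u a) = 1" for a
      using complex_norm_square[of "u a"] that by simp
    then show ?thesis
      by (simp add: D_def L_def of_bool_def if_distrib[of "\<lambda>z. z * _"] cong: if_cong)
  qed
  have weight: "x a * cnj (x c) * (y b * cnj (y d)) *
      complex_of_real (1 - (of_bool (a = c) + of_bool (b = d)) / L + of_bool (a = c) * of_bool (b = d)) =
      (x a * cnj (x c)) * (y b * cnj (y d)) - (D x a c * (y b * cnj (y d))) / L
      - (x a * cnj (x c) * D y b d) / L + D x a c * D y b d" for a b c d
    by (simp add: D_def algebra_simps add_divide_distrib)
  have L: "L \<noteq> 0"
    by (simp add: L_def)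
  \<comment> \<open>The complex sum factors, whereas its termwise real parts do not; the real part
    is therefore taken last.\<close>
  have "complex_of_real ?lhs = complex_of_real (Re (\<Sum>a\<in>UNIV. \<Sum>c\<in>UNIV. \<Sum>b\<in>UNIV. \<Sum>d\<in>UNIV.
      x a * cnj (x c) * (y b * cnj (y d)) *
      complex_of_real (1 - (of_bool (a = c) + of_bool (b = d)) / L + of_bool (a = c) * of_bool (b = d))))"
    by (simp only: Re_sum Re_mult_of_real)
  also have "(\<Sum>a\<in>UNIV. \<Sum>c\<in>UNIV. \<Sum>b\<in>UNIV. \<Sum>d\<in>UNIV.
      x a * cnj (x c) * (y b * cnj (y d)) *
      complex_of_real (1 - (of_bool (a = c) + of_bool (b = d)) / L + of_bool (a = c) * of_bool (b = d)))
      = complex_of_real ?rhs"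
    unfolding weight sum.distrib sum_subtractf sum_divide_distrib[symmetric] sum4_product full
      diag[OF x] diag[OF y]
    using L by (simp add: field_simps power2_eq_square)
  finally show ?thesis
    by (simp only: Re_complex_of_real of_real_eq_iff)
qed

section \<open>Averaging over the rotation, then over the couplings\<close>

theorem mainTheorem2:
  fixes M :: "'w measure" and N q :: nat and T :: real
    and \<psi> :: "nat \<Rightarrow> complex^'l^'l"
    and J1 J2 :: "'w \<Rightarrow> nat set \<Rightarrow> real"
    and E1 E2 :: "'w \<Rightarrow> real^'l"
    and V1 V2 U1 U2 :: "'w \<Rightarrow> complex^'l^'l"
  assumes "even N" and "N > 0" and "even q" and "q \<ge> 4"
    and "CARD('l) = 2 ^ (N div 2)"
    and "majorana_fermions N \<psi>"
    and "prob_space M"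
    and "distr M (syk_couplings N q) J1 = syk_couplings N q"
    and "distr M (syk_couplings N q) J2 = syk_couplings N q"
    and "prob_space.indep_var M (syk_couplings N q) J1 (syk_couplings N q) J2"
    and "\<And>\<omega>. \<omega> \<in> space M \<Longrightarrow> has_spectrum (syk_hamiltonian N q \<psi> (J1 \<omega>)) (E1 \<omega>)"
    and "\<And>\<omega>. \<omega> \<in> space M \<Longrightarrow> has_spectrum (syk_hamiltonian N q \<psi> (J2 \<omega>)) (E2 \<omega>)"
    and "\<And>\<omega>. \<omega> \<in> space M \<Longrightarrow> unitary_mat (V1 \<omega>)"
    and "\<And>\<omega>. \<omega> \<in> space M \<Longrightarrow> unitary_mat (V2 \<omega>)"
    and "haar_unitary (distr M borel (\<lambda>\<omega>. dagger (V1 \<omega>) ** V2 \<omega>))"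
    and "independent_rvs M borel (\<lambda>\<omega>. dagger (V1 \<omega>) ** V2 \<omega>) borel (\<lambda>\<omega>. (E1 \<omega>, E2 \<omega>))"
    and "\<And>\<omega>. \<omega> \<in> space M \<Longrightarrow> U1 \<omega> = evolution (eigenbasis_hamiltonian (V1 \<omega>) (E1 \<omega>)) T"
    and "\<And>\<omega>. \<omega> \<in> space M \<Longrightarrow> U2 \<omega> = evolution (eigenbasis_hamiltonian (V2 \<omega>) (E2 \<omega>)) T"
  shows "first_frame_potential M U1 U2 =
    (spectral_form_factor N q \<psi> T - 1)\<^sup>2 / ((real CARD('l))\<^sup>2 - 1) + 1"
proof -
  interpret prob_space M
    by fact
  define L where "L = real CARD('l)"
  define V where "V = (\<lambda>\<omega>. dagger (V1 \<omega>) ** V2 \<omega>)"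
  define w where "w = (\<lambda>(a :: 'l) (c :: 'l) (b :: 'l) (d :: 'l). (1 - (of_bool (a = c) + of_bool (b = d)) / L +
      of_bool (a = c) * of_bool (b = d)) :: real)"
  \<comment> \<open>The phases in \<open>x\<close> are conjugated because \<open>U1\<close> enters
    through its adjoint.\<close>
  define x y where "x = (\<lambda>(e :: (real^'l) \<times> (real^'l)) a. cnj (cis (- (fst e $ a * T))))"
    and "y = (\<lambda>(e :: (real^'l) \<times> (real^'l)) b. cis (- (snd e $ b * T)))"
  define g where "g = (\<lambda>a c b d (e :: (real^'l) \<times> (real^'l)).
      Re (x e a * cnj (x e c) * (y e b * cnj (y e d))))"
  define f where "f = (\<lambda>a c b d (W :: complex^'l^'l). (cmod (W $ a $ b))\<^sup>2 * (cmod (W $ c $ d))\<^sup>2)"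
  define F where "F = (\<lambda>J. (cmod (trace (evolution (syk_hamiltonian N q \<psi> J) T)))\<^sup>2)"
  have "(2::nat) ^ 1 \<le> 2 ^ (N div 2)"
    using assms(1,2) by (intro power_increasing) auto
  then have card: "CARD('l) \<ge> 2"
    using assms(5) by simp
  have "L\<^sup>2 \<ge> 2\<^sup>2"
    using card by (intro power_mono) (auto simp: L_def)
  then have L: "L\<^sup>2 - 1 \<noteq> 0"
    by simp
  have x1: "cmod (x e a) = 1" and y1: "cmod (y e a) = 1" for e a
    by (simp_all add: x_def y_def)
  have V: "unitary_mat (V \<omega>)" if "\<omega> \<in> space M" for \<omega>
    using assms(13,14) that by (simp add: V_def unitary_mat_dagger_mult)
  have indep: "independent_rvs M borel V borel (\<lambda>\<omega>. (E1 \<omega>, E2 \<omega>))"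
    using assms(16) by (simp add: V_def)
  then have Vm: "V \<in> borel_measurable M" and Em: "(\<lambda>\<omega>. (E1 \<omega>, E2 \<omega>)) \<in> borel_measurable M"
    by (auto simp: independent_rvs_def)
  have gm: "g a c b d \<in> borel_measurable borel" for a c b d
    unfolding g_def x_def y_def cis_conv_exp
    by (intro borel_measurable_continuous_onI continuous_intros)
  have fm: "f a c b d \<in> borel_measurable borel" for a c b d
    unfolding f_def by (intro borel_measurable_continuous_onI continuous_intros)
  have gi: "integrable M (\<lambda>\<omega>. g a c b d (E1 \<omega>, E2 \<omega>))" for a c b d
  proof (rule integrable_const_bound[where B = 1])
    have "norm (g a c b d e) \<le> 1" for e
      unfolding g_def real_norm_def
      by (rule order_trans[OF abs_Re_le_cmod]) (simp add: norm_mult x1 y1)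
    then show "AE \<omega> in M. norm (g a c b d (E1 \<omega>, E2 \<omega>)) \<le> 1"
      by simp
  qed (rule measurable_compose[OF Em gm])
  have fi: "integrable M (\<lambda>\<omega>. f a c b d (V \<omega>))" for a c b d
  proof (rule integrable_const_bound[where B = 1])
    show "AE \<omega> in M. norm (f a c b d (V \<omega>)) \<le> 1"
      using unitary_entry_le_1[OF V]
      by (auto simp: f_def intro!: AE_I2 mult_le_one power_le_one)
  qed (rule measurable_compose[OF Vm fm])
  have moment: "(\<integral>\<omega>. f a c b d (V \<omega>) \<partial>M) = w a c b d / (L\<^sup>2 - 1)" for a c b d
    using haar_second_moment[OF assms(15) card, of a b c d] integral_distr[OF Vm fm, of a c b d]
    by (simp add: f_def w_def L_def V_def)
  have expand: "(cmod (trace (dagger (U1 \<omega>) ** U2 \<omega>)))\<^sup>2 =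
      (\<Sum>a\<in>UNIV. \<Sum>c\<in>UNIV. \<Sum>b\<in>UNIV. \<Sum>d\<in>UNIV. f a c b d (V \<omega>) * g a c b d (E1 \<omega>, E2 \<omega>))"
    if "\<omega> \<in> space M" for \<omega>
  proof -
    have "trace (dagger (U1 \<omega>) ** U2 \<omega>) = (\<Sum>a\<in>UNIV. \<Sum>b\<in>UNIV.
        x (E1 \<omega>, E2 \<omega>) a * y (E1 \<omega>, E2 \<omega>) b * complex_of_real ((cmod (V \<omega> $ a $ b))\<^sup>2))"
      using assms(13,14,17,18) that
      by (simp add: evolution_eigenbasis trace_conj_cdiag_mult x_def y_def V_def)
    then show ?thesis
      by (simp only: cmod_bilinear_sum_power2 f_def g_def) (simp only: mult_ac)
  qed
  \<comment> \<open>The diagonalizing matrix from \<open>has_spectrum\<close> may differ from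
    \<open>V1\<close> and \<open>V2\<close>, but the trace depends only on the eigenvalues. This
    ties the phase sums to the couplings.\<close>
  have spectral: "trace (evolution H T) = (\<Sum>a\<in>UNIV. cis (- (E $ a * T)))"
    if "has_spectrum H E" for H :: "complex^'l^'l" and E
    using that unfolding has_spectrum_def eigenbasis_hamiltonian_def[symmetric]
    by (auto simp: evolution_eigenbasis trace_conj_cdiag)
  have F1: "F (J1 \<omega>) = (cmod (\<Sum>a\<in>UNIV. x (E1 \<omega>, E2 \<omega>) a))\<^sup>2"
    and F2: "F (J2 \<omega>) = (cmod (\<Sum>a\<in>UNIV. y (E1 \<omega>, E2 \<omega>) a))\<^sup>2"
    if "\<omega> \<in> space M" for \<omega>
    using spectral[OF assms(11)[OF that]] spectral[OF assms(12)[OF that]]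
    by (simp_all add: F_def x_def y_def cnj_sum[symmetric] del: cnj_sum)
  \<comment> \<open>The order in which \<open>E1\<close> and \<open>E2\<close> list the eigenvalues
    may vary with the sample point, so independence is drawn from the couplings, through the
    order-free quantity \<open>F\<close>.\<close>
  have Fm: "F \<in> borel_measurable (syk_couplings N q)"
    unfolding F_def by (rule borel_measurable_syk_form_factor)
  have J1m: "J1 \<in> measurable M (syk_couplings N q)" and J2m: "J2 \<in> measurable M (syk_couplings N q)"
    using assms(10) by (auto dest: indep_var_rv1 indep_var_rv2)
  have bound: "(cmod (\<Sum>a\<in>UNIV. u a))\<^sup>2 \<le> L\<^sup>2" if "\<And>a. cmod (u a) = 1" for u :: "'l \<Rightarrow> complex"
    using sum_norm_le[of UNIV u "\<lambda>_. 1"] that by (intro power_mono) (auto simp: L_def)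
  have Fi1: "integrable M (\<lambda>\<omega>. F (J1 \<omega>))"
    by (rule integrable_const_bound[where B = "L\<^sup>2"])
       (auto simp: F1 intro!: AE_I2 bound x1 measurable_compose[OF J1m Fm])
  have Fi2: "integrable M (\<lambda>\<omega>. F (J2 \<omega>))"
    by (rule integrable_const_bound[where B = "L\<^sup>2"])
       (auto simp: F2 intro!: AE_I2 bound y1 measurable_compose[OF J2m Fm])
  have SFF1: "(\<integral>\<omega>. F (J1 \<omega>) \<partial>M) = spectral_form_factor N q \<psi> T"
    using integral_distr[OF J1m Fm] assms(8) by (simp add: spectral_form_factor_def F_def)
  have SFF2: "(\<integral>\<omega>. F (J2 \<omega>) \<partial>M) = spectral_form_factor N q \<psi> T"
    using integral_distr[OF J2m Fm] assms(9) by (simp add: spectral_form_factor_def F_def)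
  have "(\<lambda>J. F J - 1) \<in> borel_measurable (syk_couplings N q)"
    using Fm by simp
  from indep_var_compose[OF assms(10) this this]
  have F_indep: "indep_var borel (\<lambda>\<omega>. F (J1 \<omega>) - 1) borel (\<lambda>\<omega>. F (J2 \<omega>) - 1)"
    by (simp add: comp_def)
  have F1i: "integrable M (\<lambda>\<omega>. F (J1 \<omega>) - 1)" and F2i: "integrable M (\<lambda>\<omega>. F (J2 \<omega>) - 1)"
    using Fi1 Fi2 by auto
  note F_prod = indep_var_lebesgue_integral[OF F_indep F1i F2i] indep_var_integrable[OF F_indep F1i F2i]

  have "first_frame_potential M U1 U2 = (\<integral>\<omega>. (\<Sum>a\<in>UNIV. \<Sum>c\<in>UNIV. \<Sum>b\<in>UNIV. \<Sum>d\<in>UNIV.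
      f a c b d (V \<omega>) * g a c b d (E1 \<omega>, E2 \<omega>)) \<partial>M)"
    unfolding first_frame_potential_def by (rule Bochner_Integration.integral_cong) (auto simp: expand)
  also have "\<dots> = (\<Sum>a\<in>UNIV. \<Sum>c\<in>UNIV. \<Sum>b\<in>UNIV. \<Sum>d\<in>UNIV.
      w a c b d / (L\<^sup>2 - 1) * (\<integral>\<omega>. g a c b d (E1 \<omega>, E2 \<omega>) \<partial>M))"
    by (simp add: independent_rvs_integral_mult[OF indep fm gm fi gi] moment)
  \<comment> \<open>With the rotation averaged out, the sums return under the integral so that the
    contraction can be done pointwise in the eigenvalues.\<close>
  also have "\<dots> = (\<integral>\<omega>. (\<Sum>a\<in>UNIV. \<Sum>c\<in>UNIV. \<Sum>b\<in>UNIV. \<Sum>d\<in>UNIV.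
      g a c b d (E1 \<omega>, E2 \<omega>) * w a c b d) / (L\<^sup>2 - 1) \<partial>M)"
    using gi by (simp add: sum_divide_distrib mult_ac)
  also have "\<dots> = (\<integral>\<omega>. (F (J1 \<omega>) - 1) * (F (J2 \<omega>) - 1) / (L\<^sup>2 - 1) + 1 \<partial>M)"
  proof (rule Bochner_Integration.integral_cong)
    fix \<omega> assume \<omega>: "\<omega> \<in> space M"
    have "(\<Sum>a\<in>UNIV. \<Sum>c\<in>UNIV. \<Sum>b\<in>UNIV. \<Sum>d\<in>UNIV. g a c b d (E1 \<omega>, E2 \<omega>) * w a c b d) =
        (F (J1 \<omega>) - 1) * (F (J2 \<omega>) - 1) + (L\<^sup>2 - 1)"
      using haar_weighted_phase_sum[of "x (E1 \<omega>, E2 \<omega>)" "y (E1 \<omega>, E2 \<omega>)", OF x1 y1]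
      unfolding F1[OF \<omega>] F2[OF \<omega>] g_def w_def L_def .
    then show "(\<Sum>a\<in>UNIV. \<Sum>c\<in>UNIV. \<Sum>b\<in>UNIV. \<Sum>d\<in>UNIV. g a c b d (E1 \<omega>, E2 \<omega>) * w a c b d) / (L\<^sup>2 - 1) =
        (F (J1 \<omega>) - 1) * (F (J2 \<omega>) - 1) / (L\<^sup>2 - 1) + 1"
      using L by (simp add: add_divide_distrib)
  qed simp
  also have "\<dots> = (\<integral>\<omega>. (F (J1 \<omega>) - 1) * (F (J2 \<omega>) - 1) \<partial>M) / (L\<^sup>2 - 1) + 1"
    using F_prod(2) by (simp add: prob_space)
  \<comment> \<open>Independence factors the mean, and the common law of the couplings makes both
    factors equal.\<close>
  also have "\<dots> = (spectral_form_factor N q \<psi> T - 1)\<^sup>2 / (L\<^sup>2 - 1) + 1"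
    using Fi1 Fi2 by (simp add: F_prod(1) SFF1 SFF2 prob_space power2_eq_square)
  finally show ?thesis
    by (simp add: L_def)
qed

end
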